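(* Let $(D,S)$ be a relational system on $A$ satisfying Condition 1 and let $R_1,\dots,R_M\subseteq A$ ($M\ge 2$) satisfy Condition 2 (both conditions are spelled out in the context). The conjoint assignment rule has the following stability properties with respect to merging and splitting operations, where "range" means the range assigned by the conjoint assignment rule. 1. After a merging operation: (a) an action that was classified into a range of classes which does not contain the merged classes keeps its assignment to the same range; (b) an action that was classified into a range of adjacent classes whose lower and upper limits are merged is assigned to the new class; (c) an action that was classified into a range of classes whose lower (respectively upper) limit was merged is assigned to a range composed of the same upper (respectively lower) limit and the new class; (d) when the merging is carried out with two classes that are within the range to which an action was assigned (neither of them being the lower or the upper limit of the range), the action is classified into the same range as before the merging. 2. After a splitting operation: (a) when the split class is adjacent to one of the limits of the assignment range of an action $x$, the new assignment range is the same, or the old limit is replaced by one of the new classes; (b) when one of the limits of the assignment range is split, the new limit is one of the new classes, or one of their adjacent classes; (c) when the split class is neither a limit of the assignment range nor one of the classes adjacent to the limits, the assignment range keeps its limit classes.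
   Context: $A$ is the set of actions (all actions to be classified and all representative actions). $C=\{C_1,\dots,C_M\}$, $M\ge 2$, is a set of ordered classes, $C_M$ being the highest. Condition 1: $D$ and $S$ are binary relations on $A$ such that $D$ is transitive, $S$ is reflexive, and for all $x,y,z\in A$: $xDy\Rightarrow xSy$; ($xSy$ and $yDz$) $\Rightarrow xSz$; ($xDy$ and $ySz$) $\Rightarrow xSz$. ($S$ is also required to be "compatible with the order of the classes", i.e. $xSy$ gives an argument to believe that $x$ should be classified into a class equal to or higher than that of $y$; this is interpretive.) Condition 2: each class $C_k$ is characterized by a nonempty finite set $R_k\subseteq A$ of representative actions such that (a) for $k=1,\dots,M-1$ and every $w\in R_k$ there is $z\in R_{k+1}$ with $zDw$; (b) for $k=1,\dots,M-1$ and every $w\in R_{k+1}$ there is $z\in R_k$ with $wDz$; (c) for all $1\le k<h\le M$ and every $w\in R_h$ there is no $z\in R_k$ with $zSw$. Notation: $xSR_k$ iff there is $z\in R_k$ with $xSz$; $R_kSx$ iff there is $w\in R_k$ with $wSx$. Descending assignment rule: by convention $xSR_0$ holds for all $x$. Let $k$ be the largest element of $\{0,\dots,M\}$ with $xSR_k$. If $k=M$, assign $x$ to $C_M$; if $k=0$, assign $x$ to $C_1$; if $0<k<M$, assign $x$ to the range $C_k-C_{k+1}$ (both classes possible). Ascending assignment rule: by convention $R_{M+1}Sx$ holds for all $x$. Let $k$ be the smallest element of $\{1,\dots,M+1\}$ with $R_kSx$. If $k=1$, assign $x$ to $C_1$; if $k=M+1$, assign $x$ to $C_M$; if $1<k<M+1$,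 assign $x$ to the range $C_{k-1}-C_k$ (both classes possible). Assignment to a single class $C_k$ is regarded as assignment to the range $C_k-C_k$. For a range $C_k-C_h$, the classes $C_k$ and $C_h$ are called its limits. Conjoint assignment rule: (a) if $x$ is assigned to $C_M$ by the descending rule and to $C_1$ by the ascending rule, the conjoint range is $C_1-C_M$; (b) if $x$ is assigned to the same range $C_h-C_{h+1}$ by both rules, the conjoint range is $C_h-C_{h+1}$; (c) if $x$ is assigned to $C_h-C_{k'}$ by the ascending rule and to $C_{k''}-C_{h'}$ by the descending rule, the conjoint range is $C_{k'}-C_{k''}$ if $k''\ge k'$, and $C_{k''}-C_{k'}$ if $k''<k'$. Thus the two limits of the conjoint range are the lower limit of the descending range and the upper limit of the ascending range. Merging operation: two adjacent classes $C_k,C_{k+1}$ are merged into a new class $C'_k$ characterized by $R'_k=R_k\cup R_{k+1}$. The other classes and their sets of representative actions are unchanged and only renumbered: $C'_i=C_i$, $R'_i=R_i$ for $i<k$, and $C'_{i-1}=C_i$, $R'_{i-1}=R_i$ for $i>k+1$. The rules are then applied with the $M-1$ classes $C'_1,\dots,C'_{M-1}$ and sets $R'_1,\dots,R'_{M-1}$. Splitting operation: a class $C_k$ is split into two new adjacent classes, the lower one $C'_k$ and the upper one $C'_{k+1}$, characterized by two new distinct sets of representative actions $R'_k,R'_{k+1}\subseteq A$ (whose union may differ from $R_k$). The other classes are unchanged and only renumbered: $C'_i=C_i$, $R'_i=R_i$ for $i<k$, and $C'_{i+1}=C_i$, $R'_{i+1}=R_i$ for $i>k$. The new family $R'_1,\dots,R'_{M+1}$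 is required to satisfy Condition 2 (with $M+1$ in place of $M$). The rules are then applied with these $M+1$ classes. "The same" class, range or limit after an operation is understood up to this renumbering of the unchanged classes. *)

theory Defs
  imports Main
begin

definition condition1 :: "'a set \<Rightarrow> ('a \<Rightarrow> 'a \<Rightarrow> bool) \<Rightarrow> ('a \<Rightarrow> 'a \<Rightarrow> bool) \<Rightarrow> bool" where
  "condition1 A D S \<longleftrightarrow>
     transp_on A D \<and> reflp_on A S \<and>
     (\<forall>x\<in>A. \<forall>y\<in>A. D x y \<longrightarrow> S x y) \<and>
     (\<forall>x\<in>A. \<forall>y\<in>A. \<forall>z\<in>A. S x y \<and> D y z \<longrightarrow> S x z) \<and>
     (\<forall>x\<in>A. \<forall>y\<in>A. \<forall>z\<in>A. D x y \<and> S y z \<longrightarrow> S x z)"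

text \<open>
  The classes are numbered from 1 to M, and class number k is given by its set \<open>R k\<close> of
  representative actions. Values of \<open>R\<close> outside \<open>{1..M}\<close> play no role.
\<close>

definition condition2 ::
  "'a set \<Rightarrow> ('a \<Rightarrow> 'a \<Rightarrow> bool) \<Rightarrow> ('a \<Rightarrow> 'a \<Rightarrow> bool) \<Rightarrow> nat \<Rightarrow> (nat \<Rightarrow> 'a set) \<Rightarrow> bool" where
  "condition2 A D S M R \<longleftrightarrow>
     (\<forall>k\<in>{1..M}. R k \<noteq> {} \<and> finite (R k) \<and> R k \<subseteq> A) \<and>
     (\<forall>k\<in>{1..<M}. \<forall>w\<in>R k. \<exists>z\<in>R (Suc k). D z w) \<and>
     (\<forall>k\<in>{1..<M}. \<forall>w\<in>R (Suc k). \<exists>z\<in>R k. D w z) \<and>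
     (\<forall>k h. 1 \<le> k \<and> k < h \<and> h \<le> M \<longrightarrow> (\<forall>w\<in>R h. \<not> (\<exists>z\<in>R k. S z w)))"

definition rel_set :: "('a \<Rightarrow> 'a \<Rightarrow> bool) \<Rightarrow> 'a \<Rightarrow> 'a set \<Rightarrow> bool" where
  "rel_set S x Z \<longleftrightarrow> (\<exists>z\<in>Z. S x z)"

definition set_rel :: "('a \<Rightarrow> 'a \<Rightarrow> bool) \<Rightarrow> 'a set \<Rightarrow> 'a \<Rightarrow> bool" where
  "set_rel S W x \<longleftrightarrow> (\<exists>w\<in>W. S w x)"

text \<open>
  A range of classes is the pair (lower limit, upper limit) of class numbers; a single class k is
  the range (k, k). The disjuncts \<open>k = 0\<close> and \<open>k = Suc M\<close> below are the conventions
  that the relation holds for the fictitious classes 0 and M + 1.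
\<close>

definition descending_range ::
  "('a \<Rightarrow> 'a \<Rightarrow> bool) \<Rightarrow> nat \<Rightarrow> (nat \<Rightarrow> 'a set) \<Rightarrow> 'a \<Rightarrow> nat \<times> nat" where
  "descending_range S M R x =
     (let k = Max {k\<in>{0..M}. k = 0 \<or> rel_set S x (R k)}
      in if k = M then (M, M) else if k = 0 then (1, 1) else (k, Suc k))"

definition ascending_range ::
  "('a \<Rightarrow> 'a \<Rightarrow> bool) \<Rightarrow> nat \<Rightarrow> (nat \<Rightarrow> 'a set) \<Rightarrow> 'a \<Rightarrow> nat \<times> nat" where
  "ascending_range S M R x =
     (let k = Min {k\<in>{1..Suc M}. k = Suc M \<or> set_rel S (R k) x}
      in if k = 1 then (1, 1) else if k = Suc M then (M, M) else (k - 1, k))"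

definition conjoint_range ::
  "('a \<Rightarrow> 'a \<Rightarrow> bool) \<Rightarrow> nat \<Rightarrow> (nat \<Rightarrow> 'a set) \<Rightarrow> 'a \<Rightarrow> nat \<times> nat" where
  "conjoint_range S M R x =
     (let (al, au) = ascending_range S M R x; (dl, du) = descending_range S M R x
      in if (dl, du) = (M, M) \<and> (al, au) = (1, 1) then (1, M)
         else if (dl, du) = (al, au) \<and> au = Suc al then (al, au)
         else if dl \<ge> au then (au, dl)
         else (dl, au))"

definition merge_classes :: "nat \<Rightarrow> (nat \<Rightarrow> 'a set) \<Rightarrow> nat \<Rightarrow> 'a set" where
  "merge_classes k R i =
     (if i < k then R i else if i = k then R k \<union> R (Suc k) else R (Suc i))"

text \<open>
  \<open>merge_index k i\<close> is the number, after classes k and k + 1 have been merged, of the class that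
  old class i has become; both merged classes become the new class, which has number k.
\<close>

definition merge_index :: "nat \<Rightarrow> nat \<Rightarrow> nat" where
  "merge_index k i = (if i \<le> k then i else i - 1)"

text \<open>\<open>R'\<close> arises from \<open>R\<close> by splitting class k into the new classes k and k + 1.\<close>

definition is_splitting ::
  "'a set \<Rightarrow> ('a \<Rightarrow> 'a \<Rightarrow> bool) \<Rightarrow> ('a \<Rightarrow> 'a \<Rightarrow> bool) \<Rightarrow> nat \<Rightarrow> (nat \<Rightarrow> 'a set) \<Rightarrow> nat \<Rightarrow>
     (nat \<Rightarrow> 'a set) \<Rightarrow> bool" where
  "is_splitting A D S M R k R' \<longleftrightarrow>
     (\<forall>i\<in>{1..<k}. R' i = R i) \<and> (\<forall>i\<in>{k<..M}. R' (Suc i) = R i) \<and>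
     R' k \<noteq> R' (Suc k) \<and> condition2 A D S (Suc M) R'"

text \<open>
  \<open>split_index k i\<close> is the number, after class k has been split, of the unchanged class i;
  it is meaningful only for \<open>i \<noteq> k\<close>.
\<close>

definition split_index :: "nat \<Rightarrow> nat \<Rightarrow> nat" where
  "split_index k i = (if i < k then i else Suc i)"

definition adjacent :: "nat \<Rightarrow> nat \<Rightarrow> bool" where
  "adjacent i j \<longleftrightarrow> j = Suc i \<or> i = Suc j"

end

theory Submission
  imports Defs
begin

text \<open>
  By domination, the relation \<open>x S R\<^sub>k\<close> is downward closed in \<open>k\<close> and \<open>R\<^sub>k S x\<close> is upward
  closed, so an action is described by two thresholds \<open>d\<close> and \<open>a\<close>: the first relation holds iff
  \<open>k \<le> d\<close>, the second iff \<open>a \<le> k\<close>. The conjoint range is spanned by \<open>max 1 d\<close> and \<open>min M a\<close>,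
  in whichever order. Merging acts on both thresholds by renumbering. Splitting class \<open>k\<close>
  renumbers them too, except that \<open>d \<in> {k - 1, k}\<close> may move anywhere in \<open>{k - 1..k + 1}\<close> and
  \<open>a \<in> {k, k + 1}\<close> anywhere in \<open>{k..k + 2}\<close>.
\<close>

section \<open>Thresholds locating an action among the representative sets\<close>

text \<open>An equivalence for every class, rather than a maximum, allows comparing two families
  class by class; \<open>d = 0\<close> stands for the fictitious class 0.\<close>

definition desc_threshold ::
  "('a \<Rightarrow> 'a \<Rightarrow> bool) \<Rightarrow> nat \<Rightarrow> (nat \<Rightarrow> 'a set) \<Rightarrow> 'a \<Rightarrow> nat \<Rightarrow> bool" where
  "desc_threshold S M R x d \<longleftrightarrow> d \<le> M \<and> (\<forall>i\<in>{1..M}. rel_set S x (R i) \<longleftrightarrow> i \<le> d)"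

definition asc_threshold ::
  "('a \<Rightarrow> 'a \<Rightarrow> bool) \<Rightarrow> nat \<Rightarrow> (nat \<Rightarrow> 'a set) \<Rightarrow> 'a \<Rightarrow> nat \<Rightarrow> bool" where
  "asc_threshold S M R x a \<longleftrightarrow>
     1 \<le> a \<and> a \<le> Suc M \<and> (\<forall>i\<in>{1..M}. set_rel S (R i) x \<longleftrightarrow> a \<le> i)"

text \<open>Every \<open>w\<close> in \<open>R (Suc n)\<close> dominates some \<open>z\<close> in
  \<open>R n\<close>, and \<open>S\<close> followed by \<open>D\<close> stays in \<open>S\<close>;
  so the relation descends one class at a time.\<close>

lemma rel_set_antimono:
  assumes "condition1 A D S" "condition2 A D S M R" "x \<in> A"
    and "i \<le> j" "1 \<le> i" "j \<le> M" "rel_set S x (R j)"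
  shows "rel_set S x (R i)"
  using assms(4-)
proof (induction rule: inc_induct)
  case (step n)
  then have "rel_set S x (R (Suc n))"
    by simp
  then obtain w where w: "w \<in> R (Suc n)" "S x w"
    by (auto simp: rel_set_def)
  have n: "n \<in> {1..<M}"
    using step(1,2) \<open>1 \<le> i\<close> \<open>j \<le> M\<close> by simp
  then have sub: "R n \<subseteq> A" "R (Suc n) \<subseteq> A"
    using assms(2) by (simp_all add: condition2_def)
  from n w(1) assms(2) obtain z where z: "z \<in> R n" "D w z"
    unfolding condition2_def by blast
  have "w \<in> A" "z \<in> A"
    using w(1) z(1) sub by auto
  with w(2) z assms(1,3) have "S x z"
    unfolding condition1_def by blast
  with z(1) show ?case
    by (auto simp: rel_set_def)
qed

text \<open>Dually, some \<open>z\<close> one class higher dominates \<open>w\<close>, and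
  \<open>D\<close> followed by \<open>S\<close> stays in \<open>S\<close>.\<close>

lemma set_rel_mono:
  assumes "condition1 A D S" "condition2 A D S M R" "x \<in> A"
    and "i \<le> j" "1 \<le> i" "j \<le> M" "set_rel S (R i) x"
  shows "set_rel S (R j) x"
  using assms(4-)
proof (induction rule: dec_induct)
  case (step n)
  then have "set_rel S (R n) x"
    by simp
  then obtain w where w: "w \<in> R n" "S w x"
    by (auto simp: set_rel_def)
  have n: "n \<in> {1..<M}"
    using step(1,2) \<open>1 \<le> i\<close> \<open>j \<le> M\<close> by simp
  then have sub: "R n \<subseteq> A" "R (Suc n) \<subseteq> A"
    using assms(2) by (simp_all add: condition2_def)
  from n w(1) assms(2) obtain z where z: "z \<in> R (Suc n)" "D z w"
    unfolding condition2_def by blast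
  have "w \<in> A" "z \<in> A"
    using w(1) z(1) sub by auto
  with w(2) z assms(1,3) have "S z x"
    unfolding condition1_def by blast
  with z(1) show ?case
    by (auto simp: set_rel_def)
qed

lemma desc_threshold_exists:
  assumes "condition1 A D S" "condition2 A D S M R" "x \<in> A"
  obtains d where "desc_threshold S M R x d"
proof -
  define K where "K = {i\<in>{0..M}. i = 0 \<or> rel_set S x (R i)}"
  have K: "finite K" "0 \<in> K"
    by (auto simp: K_def)
  have "Max K \<in> K"
    using K by (intro Max_in) auto
  then have "Max K \<le> M" and m: "Max K = 0 \<or> rel_set S x (R (Max K))"
    by (auto simp: K_def)
  moreover have "rel_set S x (R i) \<longleftrightarrow> i \<le> Max K" if i: "i \<in> {1..M}" for i
  proof
    show "i \<le> Max K" if "rel_set S x (R i)"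
      using that i K(1) by (intro Max_ge) (simp_all add: K_def)
    show "rel_set S x (R i)" if le: "i \<le> Max K"
    proof (rule rel_set_antimono[OF assms le _ \<open>Max K \<le> M\<close>])
      show "1 \<le> i"
        using i by simp
      show "rel_set S x (R (Max K))"
        using m le i by (cases "Max K = 0") simp_all
    qed
  qed
  ultimately have "desc_threshold S M R x (Max K)"
    by (simp add: desc_threshold_def)
  then show ?thesis
    by (rule that)
qed

lemma asc_threshold_exists:
  assumes "condition1 A D S" "condition2 A D S M R" "x \<in> A"
  obtains a where "asc_threshold S M R x a"
proof -
  define K where "K = {i\<in>{1..Suc M}. i = Suc M \<or> set_rel S (R i) x}"
  have K: "finite K" "Suc M \<in> K"
    by (auto simp: K_def)
  have "Min K \<in> K"
    using K by (intro Min_in) auto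
  then have "1 \<le> Min K" "Min K \<le> Suc M" and m: "Min K = Suc M \<or> set_rel S (R (Min K)) x"
    by (auto simp: K_def)
  moreover have "set_rel S (R i) x \<longleftrightarrow> Min K \<le> i" if i: "i \<in> {1..M}" for i
  proof
    show "Min K \<le> i" if "set_rel S (R i) x"
      using that i K(1) by (intro Min_le) (simp_all add: K_def)
    show "set_rel S (R i) x" if le: "Min K \<le> i"
    proof (rule set_rel_mono[OF assms le \<open>1 \<le> Min K\<close>])
      show "i \<le> M"
        using i by simp
      show "set_rel S (R (Min K)) x"
        using m le i by (cases "Min K = Suc M") simp_all
    qed
  qed
  ultimately have "asc_threshold S M R x (Min K)"
    by (simp add: asc_threshold_def)
  then show ?thesis
    by (rule that)
qed

section \<open>The conjoint range in terms of the thresholds\<close>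

text \<open>Clipping replaces the fictitious classes 0 and \<open>Suc M\<close> by 1 and
  \<open>M\<close>, which is what the two rules do in their extreme cases.\<close>

lemma conjoint_range_eq:
  assumes "1 \<le> M" and d: "desc_threshold S M R x d" and a: "asc_threshold S M R x a"
  shows "conjoint_range S M R x =
    (min (max 1 d) (min M a), max (max 1 d) (min M a))"
proof -
  have "Max {i\<in>{0..M}. i = 0 \<or> rel_set S x (R i)} = d"
  proof (rule Max_eqI)
    show "i \<le> d" if "i \<in> {i\<in>{0..M}. i = 0 \<or> rel_set S x (R i)}" for i
      using that d by (cases "i = 0") (auto simp: desc_threshold_def)
    show "d \<in> {i\<in>{0..M}. i = 0 \<or> rel_set S x (R i)}"
      using d by (cases "d = 0") (auto simp: desc_threshold_def)
  qed simp
  then have desc: "fst (descending_range S M R x) = max 1 d"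
    using \<open>1 \<le> M\<close> d by (simp add: descending_range_def desc_threshold_def)
  have "Min {i\<in>{1..Suc M}. i = Suc M \<or> set_rel S (R i) x} = a"
  proof (rule Min_eqI)
    show "a \<le> i" if "i \<in> {i\<in>{1..Suc M}. i = Suc M \<or> set_rel S (R i) x}" for i
      using that a by (cases "i = Suc M") (auto simp: asc_threshold_def)
    show "a \<in> {i\<in>{1..Suc M}. i = Suc M \<or> set_rel S (R i) x}"
      using a by (cases "a = Suc M") (auto simp: asc_threshold_def)
  qed simp
  then have asc: "snd (ascending_range S M R x) = min M a"
    using \<open>1 \<le> M\<close> a by (simp add: ascending_range_def asc_threshold_def)
  obtain p p' q' q where pq:
    "descending_range S M R x = (p, p')" "ascending_range S M R x = (q', q)"
    by fastforce
  \<comment> \<open>The special branches fit the general pattern: in them \<open>(p, q)\<close> is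
    \<open>(M, 1)\<close>, respectively \<open>(q', Suc q')\<close>.\<close>
  have "conjoint_range S M R x = (min p q, max p q)"
    using \<open>1 \<le> M\<close> unfolding conjoint_range_def pq by (auto simp: min_def max_def)
  then show ?thesis
    using desc asc pq by simp
qed

section \<open>Merging two adjacent classes\<close>

text \<open>The union \<open>R k \<union> R (Suc k)\<close> behaves like \<open>R k\<close> in the
  descending test and like \<open>R (Suc k)\<close> in the ascending one. So both thresholds are
  renumbered, and a monotone renumbering commutes with minimum and maximum.\<close>

lemma conjoint_range_merge:
  assumes c: "condition1 A D S" "condition2 A D S M R" "x \<in> A"
    and k: "k \<in> {1..<M}" and lu: "conjoint_range S M R x = (l, u)"
  shows "conjoint_range S (M - 1) (merge_classes k R) x = (merge_index k l, merge_index k u)"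
proof -
  obtain d where d: "desc_threshold S M R x d"
    using desc_threshold_exists[OF c] .
  obtain a where a: "asc_threshold S M R x a"
    using asc_threshold_exists[OF c] .
  have "rel_set S x (merge_classes k R i) \<longleftrightarrow> i \<le> merge_index k d" if "i \<in> {1..M - 1}" for i
  proof -
    have "rel_set S x (R k \<union> R (Suc k)) \<longleftrightarrow> rel_set S x (R k) \<or> rel_set S x (R (Suc k))"
      by (auto simp: rel_set_def)
    then show ?thesis
      using that d k by (auto simp: desc_threshold_def merge_classes_def merge_index_def)
  qed
  then have d': "desc_threshold S (M - 1) (merge_classes k R) x (merge_index k d)"
    using d k by (auto simp: desc_threshold_def merge_index_def)
  have "set_rel S (merge_classes k R i) x \<longleftrightarrow> merge_index k a \<le> i" if "i \<in> {1..M - 1}" for i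
  proof -
    have "set_rel S (R k \<union> R (Suc k)) x \<longleftrightarrow> set_rel S (R k) x \<or> set_rel S (R (Suc k)) x"
      by (auto simp: set_rel_def)
    then show ?thesis
      using that a k by (auto simp: asc_threshold_def merge_classes_def merge_index_def)
  qed
  then have a': "asc_threshold S (M - 1) (merge_classes k R) x (merge_index k a)"
    using a k by (auto simp: asc_threshold_def merge_index_def)
  have mono: "mono (merge_index k)"
    by (auto simp: mono_def merge_index_def)
  \<comment> \<open>Clipping commutes with renumbering, since \<open>merge_index k\<close> fixes 1
    and sends \<open>M\<close> to \<open>M - 1\<close>.\<close>
  have "max 1 (merge_index k d) = merge_index k (max 1 d)"
    "min (M - 1) (merge_index k a) = merge_index k (min M a)"
    using k a by (auto simp: merge_index_def min_def max_def asc_threshold_def)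
  moreover have "1 \<le> M" "1 \<le> M - 1"
    using k by auto
  ultimately show ?thesis
    using lu conjoint_range_eq[OF _ d a] conjoint_range_eq[OF _ d' a']
    by (auto simp: min_of_mono[OF mono] max_of_mono[OF mono])
qed

section \<open>Splitting a class\<close>

text \<open>Tests against unchanged classes agree up to renumbering. They determine
  \<open>d'\<close> unless \<open>d\<close> is \<open>k - 1\<close> or \<open>k\<close>, where they
  only exclude values below \<open>k - 1\<close> and above \<open>Suc k\<close>.\<close>

lemma split_desc_threshold:
  assumes R': "is_splitting A D S M R k R'" and k: "k \<in> {1..M}"
    and d: "desc_threshold S M R x d" and d': "desc_threshold S (Suc M) R' x d'"
  shows "if d \<in> {k - 1, k} then d' \<in> {k - 1..Suc k} else d' = split_index k d"
proof -
  have lo: "i \<le> d' \<longleftrightarrow> i \<le> d" if "i \<in> {1..<k}" for i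
  proof -
    have "R' i = R i"
      using R' that unfolding is_splitting_def by blast
    moreover have "rel_set S x (R i) \<longleftrightarrow> i \<le> d"
      using d k that by (simp add: desc_threshold_def)
    moreover have "rel_set S x (R' i) \<longleftrightarrow> i \<le> d'"
      using d' k that by (simp add: desc_threshold_def)
    ultimately show ?thesis
      by simp
  qed
  have hi: "Suc i \<le> d' \<longleftrightarrow> i \<le> d" if "i \<in> {k<..M}" for i
  proof -
    have "R' (Suc i) = R i"
      using R' that unfolding is_splitting_def by blast
    moreover have "rel_set S x (R i) \<longleftrightarrow> i \<le> d"
      using d k that by (simp add: desc_threshold_def)
    moreover have "rel_set S x (R' (Suc i)) \<longleftrightarrow> Suc i \<le> d'"
      using d' k that by (simp add: desc_threshold_def)
    ultimately show ?thesis
      by simp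
  qed
  have b: "d \<le> M" "d' \<le> Suc M"
    using d d' by (auto simp: desc_threshold_def)
  have "d' = d" if "d < k - 1"
    using that k lo[of d] lo[of "Suc d"]
    unfolding atLeastLessThan_iff atLeastAtMost_iff greaterThanAtMost_iff by presburger
  \<comment> \<open>For \<open>d = M\<close> there is no class \<open>Suc d\<close> to test; the
    bound \<open>d' \<le> Suc M\<close> takes its place.\<close>
  moreover have "d' = Suc d" if "k < d"
    using that k b hi[of d] hi[of "Suc d"]
    unfolding atLeastLessThan_iff atLeastAtMost_iff greaterThanAtMost_iff by presburger
  moreover have "k - 1 \<le> d'" if "k - 1 \<le> d"
    using that k lo[of "k - 1"]
    unfolding atLeastLessThan_iff atLeastAtMost_iff greaterThanAtMost_iff by presburger
  moreover have "d' \<le> Suc k" if "d \<le> k"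
    using that k b hi[of "Suc k"]
    unfolding atLeastLessThan_iff atLeastAtMost_iff greaterThanAtMost_iff by presburger
  ultimately show ?thesis
    by (cases "d < k - 1"; cases "k < d") (auto simp: split_index_def)
qed

text \<open>The ascending threshold is the first class passed, not the last, so the ambiguous values
  lie one higher.\<close>

lemma split_asc_threshold:
  assumes R': "is_splitting A D S M R k R'" and k: "k \<in> {1..M}"
    and a: "asc_threshold S M R x a" and a': "asc_threshold S (Suc M) R' x a'"
  shows "if a \<in> {k, Suc k} then a' \<in> {k..Suc (Suc k)} else a' = split_index k a"
proof -
  have lo: "a' \<le> i \<longleftrightarrow> a \<le> i" if "i \<in> {1..<k}" for i
  proof -
    have "R' i = R i"
      using R' that unfolding is_splitting_def by blast
    moreover have "set_rel S (R i) x \<longleftrightarrow> a \<le> i"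
      using a k that by (simp add: asc_threshold_def)
    moreover have "set_rel S (R' i) x \<longleftrightarrow> a' \<le> i"
      using a' k that by (simp add: asc_threshold_def)
    ultimately show ?thesis
      by simp
  qed
  have hi: "a' \<le> Suc i \<longleftrightarrow> a \<le> i" if "i \<in> {k<..M}" for i
  proof -
    have "R' (Suc i) = R i"
      using R' that unfolding is_splitting_def by blast
    moreover have "set_rel S (R i) x \<longleftrightarrow> a \<le> i"
      using a k that by (simp add: asc_threshold_def)
    moreover have "set_rel S (R' (Suc i)) x \<longleftrightarrow> a' \<le> Suc i"
      using a' k that by (simp add: asc_threshold_def)
    ultimately show ?thesis
      by simp
  qed
  have b: "1 \<le> a" "a \<le> Suc M" "1 \<le> a'" "a' \<le> Suc (Suc M)"
    using a a' by (auto simp: asc_threshold_def)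
  have "a' = a" if "a < k"
    using that k b lo[of a] lo[of "a - 1"]
    unfolding atLeastLessThan_iff atLeastAtMost_iff greaterThanAtMost_iff by presburger
  moreover have "a' = Suc a" if "Suc k < a"
    using that k b hi[of a] hi[of "a - 1"]
    unfolding atLeastLessThan_iff atLeastAtMost_iff greaterThanAtMost_iff by presburger
  moreover have "k \<le> a'" if "k \<le> a"
    using that k b lo[of "k - 1"]
    unfolding atLeastLessThan_iff atLeastAtMost_iff greaterThanAtMost_iff by presburger
  moreover have "a' \<le> Suc (Suc k)" if "a \<le> Suc k"
    using that k b hi[of "Suc k"]
    unfolding atLeastLessThan_iff atLeastAtMost_iff greaterThanAtMost_iff by presburger
  ultimately show ?thesis
    by (cases "a < k"; cases "Suc k < a") (auto simp: split_index_def)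
qed

text \<open>
  Splitting moves a limit \<open>i\<close> to a limit between \<open>split_lower k i\<close> and \<open>split_upper k i\<close>. Both bounds
  are monotone in \<open>i\<close>, so they survive the passage from the thresholds to their minimum and maximum.
\<close>

definition split_lower :: "nat \<Rightarrow> nat \<Rightarrow> nat" where
  "split_lower k i = (if i < k then i else if i \<le> Suc k then i - 1 else Suc i)"

definition split_upper :: "nat \<Rightarrow> nat \<Rightarrow> nat" where
  "split_upper k i =
     (if Suc i < k then i else if i < k then Suc k else if i = k then Suc (Suc k) else Suc i)"

lemma mono_split_lower: "mono (split_lower k)"
  by (auto simp: mono_def split_lower_def)

lemma mono_split_upper: "mono (split_upper k)"
  by (auto simp: mono_def split_upper_def)

text \<open>The bounds serve both thresholds: at limit \<open>k\<close>, a descending one may reach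
  \<open>k - 1\<close> and an ascending one \<open>Suc (Suc k)\<close>. For \<open>k = 1\<close> and
  \<open>d = 0\<close>, clipping makes \<open>k\<close> itself the limit.\<close>

lemma split_desc_bounds:
  assumes "if d \<in> {k - 1, k} then d' \<in> {k - 1..Suc k} else d' = split_index k d"
    and "1 \<le> k"
  shows "max 1 d' \<in> {split_lower k (max 1 d)..split_upper k (max 1 d)}"
proof -
  consider "d < k - 1" "d' = d" | "d = k - 1" "k - 1 \<le> d'" "d' \<le> Suc k"
    | "d = k" "k - 1 \<le> d'" "d' \<le> Suc k" | "k < d" "d' = Suc d"
    using assms by (auto simp: split_index_def split: if_splits)
  then show ?thesis
    using \<open>1 \<le> k\<close>
    by cases (auto simp: split_lower_def split_upper_def max_def)
qed

text \<open>Here the clipped exception is \<open>k = M\<close> and \<open>a = Suc M\<close>, with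
  limit \<open>k\<close>.\<close>

lemma split_asc_bounds:
  assumes "if a \<in> {k, Suc k} then a' \<in> {k..Suc (Suc k)} else a' = split_index k a"
    and "1 \<le> k" "k \<le> M" "a \<le> Suc M"
  shows "min (Suc M) a' \<in> {split_lower k (min M a)..split_upper k (min M a)}"
proof -
  consider "a < k" "a' = a" | "a = k" "k \<le> a'" "a' \<le> Suc (Suc k)"
    | "a = Suc k" "k \<le> a'" "a' \<le> Suc (Suc k)" | "Suc k < a" "a' = Suc a"
    using assms(1) by (auto simp: split_index_def split: if_splits)
  then show ?thesis
    using assms(2-)
    by cases (auto simp: split_lower_def split_upper_def min_def)
qed

text \<open>Membership in \<open>{1..Suc M}\<close> is recorded because for \<open>k = 1\<close> or
  \<open>k = M\<close> the bounds can name fictitious classes.\<close>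

lemma conjoint_range_split:
  assumes c: "condition1 A D S" "condition2 A D S M R" "x \<in> A"
    and k: "k \<in> {1..M}" and R': "is_splitting A D S M R k R'"
    and lu: "conjoint_range S M R x = (l, u)"
    and lu': "conjoint_range S (Suc M) R' x = (l', u')"
  shows "l' \<in> {split_lower k l..split_upper k l}" "u' \<in> {split_lower k u..split_upper k u}"
    and "l' \<in> {1..Suc M}" "u' \<in> {1..Suc M}"
proof -
  have c': "condition2 A D S (Suc M) R'"
    using R' by (simp add: is_splitting_def)
  obtain d where d: "desc_threshold S M R x d"
    using desc_threshold_exists[OF c] .
  obtain a where a: "asc_threshold S M R x a"
    using asc_threshold_exists[OF c] .
  obtain d' where d': "desc_threshold S (Suc M) R' x d'"
    using desc_threshold_exists[OF c(1) c' c(3)] .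
  obtain a' where a': "asc_threshold S (Suc M) R' x a'"
    using asc_threshold_exists[OF c(1) c' c(3)] .
  have b: "a \<le> Suc M" "d' \<le> Suc M" "1 \<le> a'"
    using a d' a' by (simp_all add: desc_threshold_def asc_threshold_def)
  define p q p' q' where
    "p = max 1 d" and "q = min M a" and "p' = max 1 d'" and "q' = min (Suc M) a'"
  note defs = this
  have eq: "l = min p q" "u = max p q" "l' = min p' q'" "u' = max p' q'"
    using lu lu' conjoint_range_eq[OF _ d a] conjoint_range_eq[OF _ d' a'] k
    by (simp_all add: defs)
  have p': "p' \<in> {split_lower k p..split_upper k p}"
    using split_desc_bounds[OF split_desc_threshold[OF R' k d d']] k by (simp add: defs)
  have q': "q' \<in> {split_lower k q..split_upper k q}"
    using split_asc_bounds[OF split_asc_threshold[OF R' k a a']] k b by (simp add: defs)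
  \<comment> \<open>Monotonicity turns a bound at a minimum or maximum into the minimum or maximum
    of the bounds at \<open>p\<close> and \<open>q\<close>.\<close>
  show "l' \<in> {split_lower k l..split_upper k l}" "u' \<in> {split_lower k u..split_upper k u}"
    using p' q' unfolding eq min_of_mono[OF mono_split_lower, symmetric]
      min_of_mono[OF mono_split_upper, symmetric] max_of_mono[OF mono_split_lower, symmetric]
      max_of_mono[OF mono_split_upper, symmetric]
    by (auto simp: min_le_iff_disj le_max_iff_disj)
  show "l' \<in> {1..Suc M}" "u' \<in> {1..Suc M}"
    using b by (auto simp: eq defs min_le_iff_disj le_max_iff_disj)
qed

section \<open>Reading off the stability properties\<close>

theorem proposition7:
  fixes A :: "'a set" and D S :: "'a \<Rightarrow> 'a \<Rightarrow> bool" and M :: nat and R :: "nat \<Rightarrow> 'a set"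
  assumes "condition1 A D S" and "M \<ge> 2" and "condition2 A D S M R"
  shows
    "(\<forall>x\<in>A. \<forall>l u. conjoint_range S M R x = (l, u) \<longrightarrow>
       (\<forall>k\<in>{1..<M}. \<forall>new. new = conjoint_range S (M - 1) (merge_classes k R) x \<longrightarrow>
          ({l..u} \<inter> {k, Suc k} = {} \<longrightarrow> new = (merge_index k l, merge_index k u)) \<and>
          (l = k \<and> u = Suc k \<longrightarrow> new = (k, k)) \<and>
          (l \<in> {k, Suc k} \<longrightarrow> new = (k, merge_index k u)) \<and>
          (u \<in> {k, Suc k} \<longrightarrow> new = (merge_index k l, k)) \<and>
          (l < k \<and> Suc k < u \<longrightarrow> new = (merge_index k l, merge_index k u))))
     \<and>
     (\<forall>x\<in>A. \<forall>l u. conjoint_range S M R x = (l, u) \<longrightarrow>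
       (\<forall>k\<in>{1..M}. \<forall>R' l' u'.
          is_splitting A D S M R k R' \<and> conjoint_range S (Suc M) R' x = (l', u') \<longrightarrow>
          (adjacent k l \<longrightarrow> l' \<in> {split_index k l, k, Suc k} \<and>
             (u \<noteq> k \<and> \<not> adjacent k u \<longrightarrow> u' = split_index k u)) \<and>
          (adjacent k u \<longrightarrow> u' \<in> {split_index k u, k, Suc k} \<and>
             (l \<noteq> k \<and> \<not> adjacent k l \<longrightarrow> l' = split_index k l)) \<and>
          (l = k \<longrightarrow>
             l' \<in> {k, Suc k} \<union> {j\<in>{1..Suc M}. adjacent j k \<or> adjacent j (Suc k)} \<and>
             (u \<noteq> k \<and> \<not> adjacent k u \<longrightarrow> u' = split_index k u)) \<and>
          (u = k \<longrightarrow>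
             u' \<in> {k, Suc k} \<union> {j\<in>{1..Suc M}. adjacent j k \<or> adjacent j (Suc k)} \<and>
             (l \<noteq> k \<and> \<not> adjacent k l \<longrightarrow> l' = split_index k l)) \<and>
          (k \<noteq> l \<and> k \<noteq> u \<and> \<not> adjacent k l \<and> \<not> adjacent k u \<longrightarrow>
             (l', u') = (split_index k l, split_index k u))))"
proof ((intro conjI; (intro ballI allI impI)?), goal_cases)
  \<comment> \<open>All merging claims are instances of the renumbering, which sends both
    \<open>k\<close> and \<open>Suc k\<close> to \<open>k\<close>.\<close>
  case (1 x l u k new)
  then have "new = (merge_index k l, merge_index k u)"
    using conjoint_range_merge[OF assms(1,3)] by simp
  then show ?case
    by (auto simp: merge_index_def)
next
  \<comment> \<open>The interval is a point for limits at distance at least two from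
    \<open>k\<close>, has three elements for adjacent limits, and for limit \<open>k\<close>
    consists of the new classes and their neighbours.\<close>
  case (2 x l u k R' l' u')
  then have "l' \<in> {split_lower k l..split_upper k l}" "u' \<in> {split_lower k u..split_upper k u}"
    "l' \<in> {1..Suc M}" "u' \<in> {1..Suc M}" "1 \<le> k"
    using conjoint_range_split[OF assms(1,3), of x k R' l u l' u'] by simp_all
  then show ?case
    unfolding adjacent_def split_index_def split_lower_def split_upper_def
    by (auto split: if_splits)
qed

end
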